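(* Let $K\subset\mathbb R^4$ be a strictly convex body, let $p\in\operatorname{int}K$, let $T\in\mathrm{Gr}_3(\mathbb R^4)$ be any hyperplane, and let $\sigma:\mathrm{Gr}_2(T)\to\mathrm{Gr}_3(\mathbb R^4)$ be a Lipschitz continuous map such that $\sigma(H)\cap T=H$ for all $H\in\mathrm{Gr}_2(T)$. Suppose that for every $H\in\mathrm{Gr}_2(T)$ the intersection $K\cap(\sigma(H)+p)$ is invariant under an affine reflection of $\sigma(H)+p$ through some line in $\sigma(H)+p$ passing through $p$, along $H$. Then $K$ is a body of affine $1$-reflection with axis passing through $p$, i.e. there exist a line $\ell\subset\mathbb R^4$ passing through $p$ and a $3$-dimensional linear subspace $V\subset\mathbb R^4$ complementary to the direction of $\ell$ such that $K$ is invariant under the affine reflection of $\mathbb R^4$ through $\ell$ along $V$.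
   Context: A convex body is a compact convex set with non-empty interior; $\operatorname{int}K$ is its interior. For a finite-dimensional real vector space $E$, $\mathrm{Gr}_k(E)$ is the Grassmannian of all $k$-dimensional linear subspaces of $E$. $\mathrm{Gr}_2(T)$ and $\mathrm{Gr}_3(\mathbb R^4)$ consist of hyperplanes of Euclidean spaces and carry the canonical metric, in which the distance between two hyperplanes is the angle in $[0,\pi/2]$ between their normal lines; Lipschitz continuity refers to these metrics. If $W$ is a finite-dimensional real affine space with direction space $\vec W$, $\ell\subset W$ is an affine subspace with direction $\vec\ell$, and $V\subset\vec W$ is a linear subspace with $\vec W=\vec\ell\oplus V$, the affine reflection of $W$ through $\ell$ along $V$ is the map $a+v\mapsto a-v$ for $a\in\ell$, $v\in V$. A set $X$ is invariant under a map $g$ if $gX=X$. *)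

theory Defs
  imports "HOL-Analysis.Analysis"
begin

definition strictly_convex_body :: "'a::euclidean_space set \<Rightarrow> bool" where
  "strictly_convex_body K \<longleftrightarrow>
     compact K \<and> convex K \<and> interior K \<noteq> {} \<and>
     (\<forall>x\<in>K. \<forall>y\<in>K. x \<noteq> y \<longrightarrow> open_segment x y \<subseteq> interior K)"

definition Gr :: "nat \<Rightarrow> 'a::euclidean_space set \<Rightarrow> 'a set set" where
  "Gr k E = {H. subspace H \<and> H \<subseteq> E \<and> dim H = k}"

definition line_angle :: "'a::euclidean_space set \<Rightarrow> 'a set \<Rightarrow> real" where
  "line_angle L M =
     (THE \<theta>. \<exists>u\<in>L. \<exists>v\<in>M. u \<noteq> 0 \<and> v \<noteq> 0 \<and> \<theta> = arccos (\<bar>u \<bullet> v\<bar> / (norm u * norm v)))"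

definition hyperplane_angle :: "'a::euclidean_space set \<Rightarrow> 'a set \<Rightarrow> 'a set \<Rightarrow> real" where
  "hyperplane_angle E H H' = line_angle (E \<inter> H\<^sup>\<bottom>) (E \<inter> H'\<^sup>\<bottom>)"

text \<open>The value 0 outside the Grassmannian is immaterial: \<^locale>\<open>Metric_space\<close> demands a
  nonnegative symmetric function on the whole type.\<close>

definition hyperplane_metric :: "'a::euclidean_space set \<Rightarrow> 'a set metric" where
  "hyperplane_metric E =
     (let G = Gr (dim E - 1) E
      in metric (G, \<lambda>H H'. if H \<in> G \<and> H' \<in> G then hyperplane_angle E H H' else 0))"

definition direction :: "'a::real_vector set \<Rightarrow> 'a set" where
  "direction A = {x - y |x y. x \<in> A \<and> y \<in> A}"

definition direct_sum :: "'a::real_vector set \<Rightarrow> 'a set \<Rightarrow> 'a set \<Rightarrow> bool" where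
  "direct_sum U A B \<longleftrightarrow> subspace A \<and> subspace B \<and> A \<inter> B = {0} \<and> U = {a + b |a b. a \<in> A \<and> b \<in> B}"

definition reflection_data :: "'a::real_vector set \<Rightarrow> 'a set \<Rightarrow> 'a set \<Rightarrow> bool" where
  "reflection_data W l V \<longleftrightarrow>
     affine W \<and> affine l \<and> l \<subseteq> W \<and> direct_sum (direction W) (direction l) V"

text \<open>Only the values on the ambient affine space \<open>W\<close> of \<open>reflection_data W l V\<close> are meaningful.\<close>

definition affine_reflection :: "'a::real_vector set \<Rightarrow> 'a set \<Rightarrow> 'a \<Rightarrow> 'a" where
  "affine_reflection l V x = (THE y. \<exists>a\<in>l. \<exists>v\<in>V. x = a + v \<and> y = a - v)"

definition affine_line :: "'a::euclidean_space set \<Rightarrow> bool" where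
  "affine_line l \<longleftrightarrow> affine l \<and> aff_dim l = 1"

lemma affine_reflection_eq:
  assumes "direct_sum U (direction l) V" "a \<in> l" "v \<in> V"
  shows "affine_reflection l V (a + v) = a - v"
  unfolding affine_reflection_def
proof (rule the_equality)
  show "\<exists>b\<in>l. \<exists>w\<in>V. a + v = b + w \<and> a - v = b - w"
    using assms by blast
next
  fix y
  assume "\<exists>b\<in>l. \<exists>w\<in>V. a + v = b + w \<and> y = b - w"
  then obtain b w where b: "b \<in> l" "w \<in> V" "a + v = b + w" "y = b - w" by blast
  have "w - v \<in> V"
    using assms b by (simp add: direct_sum_def subspace_diff)
  moreover have eq: "a - b = w - v"
    using b(3) by (simp add: algebra_simps)
  moreover have "a - b \<in> direction l"
    using assms b unfolding direction_def by blast
  ultimately have "a - b \<in> direction l \<inter> V"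
    by (metis IntI)
  moreover have "direction l \<inter> V = {0}"
    using assms(1) unfolding direct_sum_def by (elim conjE)
  ultimately have "a = b" by simp
  with eq show "y = a - v" using b(4) by simp
qed

lemma reflection_data_decompose:
  assumes "reflection_data W l V" "x \<in> W" "l \<noteq> {}"
  obtains a v where "a \<in> l" "v \<in> V" "x = a + v"
proof -
  obtain p where p: "p \<in> l" using assms by blast
  then have "x - p \<in> direction W"
    using assms unfolding reflection_data_def direction_def by blast
  then have "x - p \<in> {d + v |d v. d \<in> direction l \<and> v \<in> V}"
    using assms(1) unfolding reflection_data_def direct_sum_def by simp
  then obtain d v where d: "d \<in> direction l" "v \<in> V" "x - p = d + v"
    by blast
  then obtain s t where "s \<in> l" "t \<in> l" "d = s - t"
    unfolding direction_def by blast
  then have "p + d \<in> l"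
    using p assms mem_affine_3_minus[of l p s t 1] unfolding reflection_data_def by auto
  then show thesis
    using that[of "p + d" v] d by (simp add: algebra_simps)
qed

lemma line_angle_span:
  assumes "u \<noteq> 0" "v \<noteq> 0"
  shows "line_angle (span {u}) (span {v}) = arccos (\<bar>u \<bullet> v\<bar> / (norm u * norm v))"
  unfolding line_angle_def
proof (rule the_equality)
  show "\<exists>a\<in>span {u}. \<exists>b\<in>span {v}. a \<noteq> 0 \<and> b \<noteq> 0 \<and>
      arccos (\<bar>u \<bullet> v\<bar> / (norm u * norm v)) = arccos (\<bar>a \<bullet> b\<bar> / (norm a * norm b))"
    using assms span_base by blast
next
  fix t
  assume "\<exists>a\<in>span {u}. \<exists>b\<in>span {v}. a \<noteq> 0 \<and> b \<noteq> 0 \<and> t = arccos (\<bar>a \<bullet> b\<bar> / (norm a * norm b))"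
  then obtain j k where "j *\<^sub>R u \<noteq> 0" "k *\<^sub>R v \<noteq> 0"
     "t = arccos (\<bar>(j *\<^sub>R u) \<bullet> (k *\<^sub>R v)\<bar> / (norm (j *\<^sub>R u) * norm (k *\<^sub>R v)))"
    by (auto simp: span_singleton)
  then show "t = arccos (\<bar>u \<bullet> v\<bar> / (norm u * norm v))"
    by (simp add: abs_mult field_simps)
qed

lemma Gr_normal:
  assumes "subspace E" "dim E \<ge> 1" "H \<in> Gr (dim E - 1) E"
  obtains n where "n \<in> E" "norm n = 1" "E \<inter> H\<^sup>\<bottom> = span {n}" "H = {y \<in> E. n \<bullet> y = 0}"
proof -
  have H: "subspace H" "H \<subseteq> E" "dim H = dim E - 1"
    using assms by (auto simp: Gr_def)
  define N where "N = E \<inter> H\<^sup>\<bottom>"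
  have N: "N = {y \<in> E. \<forall>x\<in>H. orthogonal x y}"
    by (auto simp: N_def orthogonal_comp_def)
  have subN: "subspace N"
    unfolding N_def by (intro subspace_inter assms subspace_orthogonal_comp)
  have "dim N = 1"
    using dim_subspace_orthogonal_to_vectors[OF H(1) assms(1) H(2)] H(3) assms(2) N by simp
  then obtain m where m: "m \<in> N" "m \<noteq> 0"
    by (metis dim_eq_0 insertI1 subsetI zero_neq_one)
  define n where "n = m /\<^sub>R norm m"
  have n: "n \<in> N" "norm n = 1"
    using m subN by (auto simp: n_def subspace_scale)
  have "span {n} = N"
  proof (rule subspace_dim_equal[OF subspace_span subN])
    show "span {n} \<subseteq> N"
      by (rule span_minimal) (use n subN in auto)
    show "dim N \<le> dim (span {n})"
      using n(2) \<open>dim N = 1\<close> by auto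
  qed
  let ?H = "{y \<in> E. \<forall>x\<in>span {n}. orthogonal x y}"
  have nE: "span {n} \<subseteq> E" using N \<open>span {n} = N\<close> by auto
  have "H = ?H"
  proof (rule subspace_dim_equal[OF H(1)])
    have "?H = E \<inter> (span {n})\<^sup>\<bottom>"
      by (auto simp: orthogonal_comp_def)
    then show "subspace ?H"
      by (metis subspace_inter assms(1) subspace_orthogonal_comp)
    show "H \<subseteq> ?H"
      using H(2) N \<open>span {n} = N\<close> by (auto simp: orthogonal_commute)
    show "dim ?H \<le> dim H"
      using dim_subspace_orthogonal_to_vectors[OF subspace_span assms(1) nE]
        \<open>dim N = 1\<close> \<open>span {n} = N\<close> H(3) by simp
  qed
  also have "?H = {y \<in> E. n \<bullet> y = 0}"
    by (auto simp: span_singleton orthogonal_def)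
  finally have "H = {y \<in> E. n \<bullet> y = 0}" .
  moreover have "n \<in> E" using n(1) by (simp add: N_def)
  moreover have "E \<inter> H\<^sup>\<bottom> = span {n}" using \<open>span {n} = N\<close> N_def by simp
  ultimately show thesis using n(2) by (intro that)
qed

lemma arccos_abs_inner_triangle:
  fixes u v w :: "'a::euclidean_space"
  assumes "norm u = 1" "norm v = 1" "norm w = 1"
  shows "arccos \<bar>u \<bullet> w\<bar> \<le> arccos \<bar>u \<bullet> v\<bar> + arccos \<bar>v \<bullet> w\<bar>"
proof -
  have bd: "\<bar>x \<bullet> y\<bar> \<le> 1" if "norm x = 1" "norm y = 1" for x y :: 'a
    using Cauchy_Schwarz_ineq2[of x y] that by simp
  define s where "s = u \<bullet> v"
  define t where "t = v \<bullet> w"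
  have st: "\<bar>s\<bar> \<le> 1" "\<bar>t\<bar> \<le> 1" using bd assms by (auto simp: s_def t_def)
  have uw: "\<bar>u \<bullet> w\<bar> \<le> 1" using bd assms by auto
  have nn: "u \<bullet> u = 1" "v \<bullet> v = 1" "w \<bullet> w = 1"
    using assms by (auto simp: norm_eq_1)
  define x where "x = u - s *\<^sub>R v"
  define y where "y = w - t *\<^sub>R v"
  have "norm x = sqrt (1 - s\<^sup>2)"
    unfolding norm_eq_sqrt_inner x_def using nn
    by (simp add: inner_diff inner_commute s_def power2_eq_square)
  moreover have "norm y = sqrt (1 - t\<^sup>2)"
    unfolding norm_eq_sqrt_inner y_def using nn
    by (simp add: inner_diff inner_commute t_def power2_eq_square)
  moreover have "x \<bullet> y = u \<bullet> w - s * t"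
    using nn by (simp add: x_def y_def inner_diff inner_commute s_def t_def)
  ultimately have "\<bar>u \<bullet> w - s * t\<bar> \<le> sqrt (1 - s\<^sup>2) * sqrt (1 - t\<^sup>2)"
    using Cauchy_Schwarz_ineq2[of x y] by simp
  then have ge: "\<bar>u \<bullet> w\<bar> \<ge> \<bar>s\<bar> * \<bar>t\<bar> - sqrt (1 - s\<^sup>2) * sqrt (1 - t\<^sup>2)"
    using abs_mult[of s t] by linarith
  define a where "a = arccos \<bar>s\<bar>"
  define b where "b = arccos \<bar>t\<bar>"
  have ab: "0 \<le> a" "0 \<le> b" using st by (auto simp: a_def b_def intro!: arccos_lbound)
  have cs: "cos (a + b) = \<bar>s\<bar> * \<bar>t\<bar> - sqrt (1 - s\<^sup>2) * sqrt (1 - t\<^sup>2)"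
    using st by (simp add: cos_add a_def b_def cos_arccos_abs sin_arccos_abs)
  have "arccos \<bar>u \<bullet> w\<bar> \<le> a + b"
  proof (cases "a + b \<le> pi")
    case True
    have "arccos \<bar>u \<bullet> w\<bar> \<le> arccos (cos (a + b))"
      using cos_ge_minus_one[of "a + b"] cs ge uw by (intro arccos_le_arccos) auto
    then show ?thesis using True ab by (simp add: arccos_cos)
  next
    case False
    then show ?thesis using arccos_ubound[of "\<bar>u \<bullet> w\<bar>"] uw by linarith
  qed
  then show ?thesis by (simp add: a_def b_def s_def t_def)
qed

lemma Metric_space_hyperplane:
  assumes "subspace E" "dim E \<ge> 1"
    and G: "G = Gr (dim E - 1) E"
  shows "Metric_space G (\<lambda>H H'. if H \<in> G \<and> H' \<in> G then hyperplane_angle E H H' else 0)"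
proof -
  define P where "P H n \<longleftrightarrow> n \<in> E \<and> norm n = 1 \<and> E \<inter> H\<^sup>\<bottom> = span {n} \<and> H = {y \<in> E. n \<bullet> y = 0}" for H n
  have "\<exists>n. P H n" if "H \<in> G" for H
    by (rule Gr_normal[OF assms(1,2) that[unfolded G]], rule exI, unfold P_def, intro conjI)
  then have "\<forall>H\<in>G. \<exists>n. P H n" by blast
  then obtain n where P: "\<And>H. H \<in> G \<Longrightarrow> P H (n H)"
    using bchoice[of G P] by blast
  have n: "norm (n H) = 1" "E \<inter> H\<^sup>\<bottom> = span {n H}" if "H \<in> G" for H
    using P[OF that, unfolded P_def] by - (elim conjE, assumption)+
  have nH: "{y \<in> E. n H \<bullet> y = 0} = H" if "H \<in> G" for H
    by (rule P[OF that, unfolded P_def, THEN conjunct2, THEN conjunct2, THEN conjunct2, symmetric])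
  have ang: "hyperplane_angle E H H' = arccos \<bar>n H \<bullet> n H'\<bar>" if "H \<in> G" "H' \<in> G" for H H'
  proof -
    have "n H \<noteq> 0" "n H' \<noteq> 0" using n that by force+
    then show ?thesis
      using line_angle_span[of "n H" "n H'"] n that by (simp add: hyperplane_angle_def)
  qed
  have bd: "\<bar>n H \<bullet> n H'\<bar> \<le> 1" if "H \<in> G" "H' \<in> G" for H H'
    using Cauchy_Schwarz_ineq2[of "n H" "n H'"] n that by simp
  show ?thesis
  proof
    fix H H' H''
    show "0 \<le> (if H \<in> G \<and> H' \<in> G then hyperplane_angle E H H' else 0)"
      using bd by (auto simp: ang intro!: arccos_lbound)
    show "(if H \<in> G \<and> H' \<in> G then hyperplane_angle E H H' else 0) =
          (if H' \<in> G \<and> H \<in> G then hyperplane_angle E H' H else 0)"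
      by (auto simp: ang inner_commute)
    assume HH: "H \<in> G" "H' \<in> G"
    show "(if H \<in> G \<and> H' \<in> G then hyperplane_angle E H H' else 0) = 0 \<longleftrightarrow> H = H'"
    proof
      assume "(if H \<in> G \<and> H' \<in> G then hyperplane_angle E H H' else 0) = 0"
      then have "arccos \<bar>n H \<bullet> n H'\<bar> = 0" using HH ang by simp
      then have "\<bar>n H \<bullet> n H'\<bar> = 1" using bd[OF HH] cos_arccos_abs by (metis abs_idempotent cos_zero)
      then have "n H = n H' \<or> n H = - n H'"
        using norm_cauchy_schwarz_abs_eq[of "n H" "n H'"] n(1)[OF HH(1)] n(1)[OF HH(2)] by auto
      then have "{y \<in> E. n H \<bullet> y = 0} = {y \<in> E. n H' \<bullet> y = 0}"
        by (elim disjE) auto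
      then show "H = H'" using nH[OF HH(1)] nH[OF HH(2)] by simp
    next
      assume "H = H'"
      moreover have "n H \<bullet> n H = 1" using n(1)[OF HH(1)] by (simp add: norm_eq_1)
      ultimately show "(if H \<in> G \<and> H' \<in> G then hyperplane_angle E H H' else 0) = 0"
        using HH ang by simp
    qed
    assume "H'' \<in> G"
    then show "(if H \<in> G \<and> H'' \<in> G then hyperplane_angle E H H'' else 0) \<le>
        (if H \<in> G \<and> H' \<in> G then hyperplane_angle E H H' else 0) +
        (if H' \<in> G \<and> H'' \<in> G then hyperplane_angle E H' H'' else 0)"
      using HH n by (simp add: ang arccos_abs_inner_triangle)
  qed
qed

lemma mspace_hyperplane_metric:
  assumes "subspace E" "dim E \<ge> 1"
  shows "mspace (hyperplane_metric E) = Gr (dim E - 1) E"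
  unfolding hyperplane_metric_def Let_def
  by (rule Metric_space.mspace_metric[OF Metric_space_hyperplane[OF assms refl]])

lemma mdist_hyperplane_metric:
  assumes "subspace E" "dim E \<ge> 1" "H \<in> Gr (dim E - 1) E" "H' \<in> Gr (dim E - 1) E"
  shows "mdist (hyperplane_metric E) H H' = hyperplane_angle E H H'"
  unfolding hyperplane_metric_def Let_def
  by (subst Metric_space.mdist_metric[OF Metric_space_hyperplane[OF assms(1,2) refl]]) (use assms in auto)

lemma mspace_hyperplane_metric_R4:
  "mspace (hyperplane_metric (UNIV :: (real ^ 4) set)) = Gr 3 UNIV"
  "T \<in> Gr 3 (UNIV :: (real ^ 4) set) \<Longrightarrow> mspace (hyperplane_metric T) = Gr 2 T"
  by (simp_all add: mspace_hyperplane_metric Gr_def)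

end

theory Submission
  imports Defs
begin

text \<open>Let \<open>e\<close> be a normal of \<open>T\<close> and call \<open>e \<bullet> x\<close> the height of \<open>x\<close>. By strict convexity \<open>K\<close> has
  a single highest point \<open>q\<close>, and \<open>q\<close> lies strictly above the interior point \<open>p\<close>. The claim is
  that \<open>K\<close> is invariant under the reflection through the line \<open>L\<close> joining \<open>p\<close> and \<open>q\<close> along \<open>T\<close>.

  Suppose that the section \<open>K \<inter> (\<sigma> H + p)\<close> contains \<open>q\<close>. Its reflection moves points parallel to
  \<open>H \<subseteq> T\<close>, hence keeps their heights, hence fixes \<open>q\<close>
  (\<open>section_axis_through_highest_point\<close>). So the axis of the section is \<open>L\<close>, and the reflection is
  the restriction of the reflection through \<open>L\<close> along \<open>T\<close>.

  It remains to see that such sections cover \<open>K\<close>. A point \<open>x\<close> can be written as the sum of a point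
  of \<open>L\<close> and a vector \<open>w \<in> T\<close>, so it suffices to find \<open>H\<close> with \<open>w \<in> H\<close> and \<open>q - p \<in> \<sigma> H\<close>
  (\<open>hyperplane_family_through\<close>). Among the planes \<open>H\<close> containing \<open>w\<close> take a closed loop in which \<open>H\<close>
  makes a half turn. The condition \<open>\<sigma> H \<inter> T = H\<close> makes the normal of \<open>\<sigma> H\<close> follow the normal of
  \<open>H\<close>, so it is reversed along the loop, and by continuity its inner product with \<open>q - p\<close> vanishes
  somewhere.\<close>

section \<open>Hyperplanes and their unit normals\<close>

lemma hyperplane_in_Gr:
  fixes E :: "'a::euclidean_space set"
  assumes "subspace E" "n \<in> E" "norm n = 1"
  shows "{y \<in> E. n \<bullet> y = 0} \<in> Gr (dim E - 1) E"
    and "E \<inter> {y \<in> E. n \<bullet> y = 0}\<^sup>\<bottom> = span {n}"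
proof -
  let ?H = "{y \<in> E. n \<bullet> y = 0}"
  have nn: "n \<bullet> n = 1" using assms(3) by (simp add: norm_eq_1)
  have sub: "subspace ?H"
    using assms(1) by (auto simp: subspace_def inner_right_distrib)
  have eq: "?H = {y \<in> E. \<forall>x\<in>span {n}. orthogonal x y}"
    by (auto simp: span_singleton orthogonal_def)
  have nE: "span {n} \<subseteq> E"
    using assms by (simp add: span_minimal)
  have "dim (span {n}) = 1" using assms(3) by auto
  then have "dim ?H = dim E - 1"
    using dim_subspace_orthogonal_to_vectors[OF subspace_span assms(1) nE] eq by simp
  then show "?H \<in> Gr (dim E - 1) E"
    using sub by (auto simp: Gr_def)
  show "E \<inter> ?H\<^sup>\<bottom> = span {n}"
  proof
    show "span {n} \<subseteq> E \<inter> ?H\<^sup>\<bottom>"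
      using nE by (auto simp: orthogonal_comp_def orthogonal_def span_singleton inner_commute)
    show "E \<inter> ?H\<^sup>\<bottom> \<subseteq> span {n}"
    proof
      fix y assume y: "y \<in> E \<inter> ?H\<^sup>\<bottom>"
      define r where "r = y - (n \<bullet> y) *\<^sub>R n"
      have nr: "n \<bullet> r = 0"
        using nn by (simp add: r_def inner_diff_right)
      then have "r \<in> ?H"
        using y assms by (simp add: r_def subspace_diff subspace_scale)
      then have "y \<bullet> r = 0"
        using y by (auto simp: orthogonal_comp_def orthogonal_def inner_commute)
      then have "r \<bullet> r = 0"
        using nr by (simp add: r_def inner_diff_left)
      then have "y = (n \<bullet> y) *\<^sub>R n" by (simp add: r_def)
      then show "y \<in> span {n}" by (auto simp: span_singleton)
    qed
  qed
qed

lemma hyperplane_angle_normals: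
  fixes E :: "'a::euclidean_space set"
  assumes "E \<inter> H\<^sup>\<bottom> = span {m}" "E \<inter> H'\<^sup>\<bottom> = span {n}" "norm m = 1" "norm n = 1"
  shows "hyperplane_angle E H H' = arccos \<bar>m \<bullet> n\<bar>"
proof -
  have "m \<noteq> 0" "n \<noteq> 0" using assms by auto
  then show ?thesis
    using assms by (simp add: hyperplane_angle_def line_angle_span)
qed

text \<open>A chord of the unit circle is at most as long as its arc; the sign ambiguity is that of the
  normal of a hyperplane.\<close>

lemma unit_normals_close:
  fixes m n :: "'a::euclidean_space"
  assumes "norm m = 1" "norm n = 1"
  shows "norm (m - n) \<le> arccos \<bar>m \<bullet> n\<bar> \<or> norm (m + n) \<le> arccos \<bar>m \<bullet> n\<bar>"
proof -
  define t where "t = arccos \<bar>m \<bullet> n\<bar>"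
  have bd: "\<bar>m \<bullet> n\<bar> \<le> 1"
    using Cauchy_Schwarz_ineq2[of m n] assms by simp
  have t0: "0 \<le> t" using bd by (simp add: t_def arccos_lbound)
  have "cos t = \<bar>m \<bullet> n\<bar>" using bd by (simp add: t_def cos_arccos_abs)
  moreover have "1 - t\<^sup>2 / 2 \<le> cos t"
  proof -
    have "cos t = 1 - 2 * (sin (t / 2))\<^sup>2"
      using cos_double_sin[of "t / 2"] by simp
    moreover have "(sin (t / 2))\<^sup>2 \<le> (t / 2)\<^sup>2"
      using abs_sin_x_le_abs_x[of "t / 2"] by (intro iffD1[OF abs_le_square_iff]) simp
    ultimately show ?thesis by (simp add: power_divide)
  qed
  ultimately have "2 - 2 * \<bar>m \<bullet> n\<bar> \<le> t\<^sup>2" by simp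
  moreover have "m \<bullet> m = 1" "n \<bullet> n = 1" using assms by (auto simp: norm_eq_1)
  then have "(norm (m - n))\<^sup>2 = 2 - 2 * (m \<bullet> n)" "(norm (m + n))\<^sup>2 = 2 + 2 * (m \<bullet> n)"
    by (auto simp: power2_norm_eq_inner inner_diff inner_add inner_commute)
  ultimately have "(norm (m - n))\<^sup>2 \<le> t\<^sup>2 \<or> (norm (m + n))\<^sup>2 \<le> t\<^sup>2"
    by (cases "m \<bullet> n \<ge> 0") auto
  then show ?thesis
    using t0 power2_le_imp_le unfolding t_def by blast
qed

section \<open>A hyperplane of the family through two prescribed directions\<close>

text \<open>Rotate a hyperplane \<open>H\<close> of \<open>T\<close> by a half turn about a subspace of codimension two in \<open>T\<close>
  that contains \<open>w\<close>. The hyperplane \<open>\<sigma> H\<close> does not contain the normal of \<open>H\<close> in \<open>T\<close>, so this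
  normal selects a side of \<open>\<sigma> H\<close>: the unit normal of \<open>\<sigma> H\<close> that makes an acute angle with it depends
  continuously on the rotation angle. After the half turn the hyperplane is the same and the
  orientation is reversed, so somewhere on the way the normal is orthogonal to \<open>z\<close>.\<close>

lemma hyperplane_family_through:
  fixes T :: "'a::euclidean_space set" and \<sigma> :: "'a set \<Rightarrow> 'a set"
  assumes T: "subspace T" "dim T \<ge> 3"
    and lip: "Lipschitz_continuous_map (hyperplane_metric T) (hyperplane_metric UNIV) \<sigma>"
    and meet: "\<And>H. H \<in> Gr (dim T - 1) T \<Longrightarrow> \<sigma> H \<inter> T = H"
    and w: "w \<in> T"
  obtains H where "H \<in> Gr (dim T - 1) T" "w \<in> H" "z \<in> \<sigma> H"
proof -
  let ?G = "Gr (dim T - 1) T" and ?U = "Gr (DIM('a) - 1) (UNIV :: 'a set)"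
  have msp: "mspace (hyperplane_metric T) = ?G" "mspace (hyperplane_metric (UNIV :: 'a set)) = ?U"
    using T mspace_hyperplane_metric[of T] mspace_hyperplane_metric[of "UNIV :: 'a set"]
    by (simp_all add: Suc_leI)
  have \<sigma>U: "\<sigma> H \<in> ?U" if "H \<in> ?G" for H
    using lip that msp unfolding Lipschitz_continuous_map_def by auto
  obtain C where C: "\<And>H H'. H \<in> ?G \<Longrightarrow> H' \<in> ?G \<Longrightarrow>
      hyperplane_angle UNIV (\<sigma> H) (\<sigma> H') \<le> C * hyperplane_angle T H H'"
  proof -
    obtain B where B: "\<And>H H'. H \<in> ?G \<Longrightarrow> H' \<in> ?G \<Longrightarrow>
        mdist (hyperplane_metric UNIV) (\<sigma> H) (\<sigma> H') \<le> B * mdist (hyperplane_metric T) H H'"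
      using lip unfolding Lipschitz_continuous_map_def msp by blast
    show thesis
    proof (rule that[of B])
      fix H H' assume "H \<in> ?G" "H' \<in> ?G"
      then show "hyperplane_angle UNIV (\<sigma> H) (\<sigma> H') \<le> B * hyperplane_angle T H H'"
        using B[of H H'] \<sigma>U[of H] \<sigma>U[of H'] T
          mdist_hyperplane_metric[of T H H']
          mdist_hyperplane_metric[of "UNIV :: 'a set" "\<sigma> H" "\<sigma> H'"]
        by (simp add: Suc_leI)
    qed
  qed

  obtain a b where ab: "a \<in> T" "b \<in> T" "norm a = 1" "norm b = 1" "a \<bullet> b = 0" "a \<bullet> w = 0" "b \<bullet> w = 0"
  proof -
    have ex: "\<exists>a\<in>T. norm a = 1 \<and> (\<forall>x\<in>S. orthogonal x a)"
      if S: "S \<subseteq> T" "finite S" "card S < dim T" for S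
    proof -
      have sub: "span S \<subseteq> T" using S T by (simp add: span_minimal)
      have "dim (span S) < dim T"
        using S dim_le_card[of S S] by (simp add: span_superset)
      then have "dim {y \<in> T. \<forall>x\<in>span S. orthogonal x y} \<noteq> 0"
        using dim_subspace_orthogonal_to_vectors[OF subspace_span T(1) sub] by linarith
      then obtain y where y: "y \<in> T" "\<forall>x\<in>span S. orthogonal x y" "y \<noteq> 0"
        by (auto simp: dim_eq_0)
      show ?thesis
        by (rule bexI[of _ "y /\<^sub>R norm y"])
          (use y T in \<open>auto simp: subspace_scale orthogonal_def span_base\<close>)
    qed
    obtain a where a: "a \<in> T" "norm a = 1" "orthogonal w a"
      using ex[of "{w}"] w T by auto
    have "card {w, a} \<le> 2" by (simp add: card_insert_if)
    then obtain b where "b \<in> T" "norm b = 1" "orthogonal w b" "orthogonal a b"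
      using ex[of "{w, a}"] w a T by auto
    with a show thesis
      by (intro that[of a b]) (auto simp: orthogonal_def inner_commute)
  qed
  define n where "n t = cos t *\<^sub>R a + sin t *\<^sub>R b" for t
  define H where "H t = {y \<in> T. n t \<bullet> y = 0}" for t
  have ab1: "a \<bullet> a = 1" "b \<bullet> b = 1" using ab by (simp_all add: norm_eq_1)
  have n_inner: "n s \<bullet> n t = cos (s - t)" for s t
    using ab ab1 by (simp add: n_def inner_add cos_diff inner_commute)
  then have n1: "norm (n t) = 1" for t by (simp add: norm_eq_1)
  have nT: "n t \<in> T" for t
    using ab T by (simp add: n_def subspace_add subspace_scale)
  have HG: "H t \<in> ?G" and Hn: "T \<inter> (H t)\<^sup>\<bottom> = span {n t}" for t
    using hyperplane_in_Gr[OF T(1) nT n1] by (simp_all add: H_def)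
  have wH: "w \<in> H t" for t
    using w ab by (simp add: H_def n_def inner_add)

  have "\<exists>N. norm N = 1 \<and> N \<bullet> n t > 0 \<and> UNIV \<inter> (\<sigma> (H t))\<^sup>\<bottom> = span {N} \<and> \<sigma> (H t) = {y. N \<bullet> y = 0}" for t
  proof -
    obtain N where N: "norm N = 1" "UNIV \<inter> (\<sigma> (H t))\<^sup>\<bottom> = span {N}" "\<sigma> (H t) = {y. N \<bullet> y = 0}"
      using Gr_normal[of "UNIV :: 'a set" "\<sigma> (H t)"] \<sigma>U[OF HG[of t]]
      by (auto simp: Suc_leI)
    have "N \<bullet> n t \<noteq> 0"
    proof
      assume "N \<bullet> n t = 0"
      then have "n t \<in> H t" using meet[OF HG[of t]] N nT by auto
      then show False using n1[of t] by (simp add: H_def)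
    qed
    moreover have "span {- N} = span {N}"
    proof (intro subset_antisym span_minimal)
      show "{- N} \<subseteq> span {N}" by (simp add: span_neg span_base)
      show "{N} \<subseteq> span {- N}" using span_neg[OF span_base, of "- N" "{- N}"] by simp
    qed simp_all
    ultimately show ?thesis
      using N by (intro exI[of _ "if N \<bullet> n t > 0 then N else - N"]) auto
  qed
  then obtain N where N: "\<And>t. norm (N t) = 1" "\<And>t. N t \<bullet> n t > 0"
      "\<And>t. UNIV \<inter> (\<sigma> (H t))\<^sup>\<bottom> = span {N t}" "\<And>t. \<sigma> (H t) = {y. N t \<bullet> y = 0}"
    by metis

  have close: "norm (N s - N t) \<le> \<bar>C\<bar> * \<bar>s - t\<bar> \<or> norm (N s + N t) \<le> \<bar>C\<bar> * \<bar>s - t\<bar>"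
    if "\<bar>s - t\<bar> \<le> pi / 2" for s t
  proof -
    have "\<bar>n s \<bullet> n t\<bar> = cos \<bar>s - t\<bar>"
    proof -
      have "- (pi / 2) \<le> \<bar>s - t\<bar>" using pi_ge_zero by linarith
      then have "0 \<le> cos \<bar>s - t\<bar>" using that by (rule cos_ge_zero)
      then show ?thesis by (simp add: n_inner)
    qed
    moreover have "\<bar>s - t\<bar> \<le> pi" using that pi_ge_zero by linarith
    ultimately have "hyperplane_angle T (H s) (H t) = \<bar>s - t\<bar>"
      using hyperplane_angle_normals[OF Hn Hn n1 n1, of s t] arccos_cos[of "\<bar>s - t\<bar>"] by simp
    moreover have "hyperplane_angle UNIV (\<sigma> (H s)) (\<sigma> (H t)) = arccos \<bar>N s \<bullet> N t\<bar>"
      by (rule hyperplane_angle_normals[OF N(3) N(3) N(1) N(1)])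
    ultimately have "arccos \<bar>N s \<bullet> N t\<bar> \<le> C * \<bar>s - t\<bar>"
      using C[OF HG HG, of s t] by simp
    also have "\<dots> \<le> \<bar>C\<bar> * \<bar>s - t\<bar>" by (simp add: mult_right_mono)
    finally show ?thesis using unit_normals_close[OF N(1) N(1), of s t] by linarith
  qed

  have n_cont: "isCont n t" for t unfolding n_def by (intro continuous_intros)
  have N_cont: "isCont N t" for t
  proof -
    have "((\<lambda>s. \<bar>C\<bar> * \<bar>s - t\<bar> + norm (n s - n t)) \<longlongrightarrow> \<bar>C\<bar> * \<bar>t - t\<bar> + norm (n t - n t)) (at t)"
      using n_cont[of t] by (intro tendsto_intros) (auto simp: isCont_def)
    then have "\<forall>\<^sub>F s in at t. \<bar>C\<bar> * \<bar>s - t\<bar> + norm (n s - n t) < N t \<bullet> n t"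
      using N(2)[of t] by (auto dest: order_tendstoD)
    moreover have "\<forall>\<^sub>F s in at t. \<bar>s - t\<bar> \<le> pi / 2"
      unfolding eventually_at by (rule exI[of _ "pi / 2"]) (auto simp: dist_real_def)
    ultimately have "\<forall>\<^sub>F s in at t. norm (N s - N t) \<le> \<bar>C\<bar> * \<bar>s - t\<bar>"
    proof eventually_elim
      case (elim s)
      \<comment> \<open>If \<open>N s\<close> were close to \<open>- N t\<close>, it would make an obtuse angle with \<open>n s\<close>.\<close>
      have "\<not> norm (N s + N t) \<le> \<bar>C\<bar> * \<bar>s - t\<bar>"
      proof
        assume *: "norm (N s + N t) \<le> \<bar>C\<bar> * \<bar>s - t\<bar>"
        have "N s \<bullet> n s = (N s + N t) \<bullet> n s - N t \<bullet> (n s - n t) - N t \<bullet> n t"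
          by (simp add: algebra_simps)
        moreover have "(N s + N t) \<bullet> n s \<le> norm (N s + N t)"
          using norm_cauchy_schwarz[of "N s + N t" "n s"] n1 by simp
        moreover have "- (N t \<bullet> (n s - n t)) \<le> norm (n s - n t)"
          using Cauchy_Schwarz_ineq2[of "N t" "n s - n t"] N(1) by simp
        ultimately show False using elim(1) * N(2)[of s] by linarith
      qed
      then show ?case using close[OF elim(2)] by blast
    qed
    moreover have "((\<lambda>s. \<bar>C\<bar> * \<bar>s - t\<bar>) \<longlongrightarrow> 0) (at t)"
      by (rule tendsto_eq_rhs[of _ "\<bar>C\<bar> * \<bar>t - t\<bar>"]) (intro tendsto_intros, simp)
    ultimately have "((\<lambda>s. N s - N t) \<longlongrightarrow> 0) (at t)"
      by (rule Lim_null_comparison)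
    then show ?thesis by (simp add: isCont_def LIM_zero_iff)
  qed

  have npi: "n pi = - n 0" by (simp add: n_def)
  then have "H pi = H 0" by (simp add: H_def)
  then have "span {N pi} = span {N 0}" using N(3)[of pi] N(3)[of 0] by simp
  then obtain c where c: "N pi = c *\<^sub>R N 0"
    using span_base[of "N pi" "{N pi}"] by (auto simp: span_singleton)
  have "\<bar>c\<bar> = 1" using c N(1)[of pi] N(1)[of 0] by simp
  moreover have "c < 0"
    using N(2)[of pi] N(2)[of 0] c npi by (simp add: mult_less_0_iff)
  ultimately have Npi: "N pi = - N 0" using c by simp
  have "continuous_on {0..pi} (\<lambda>t. N t \<bullet> z)"
    by (intro continuous_at_imp_continuous_on ballI continuous_intros N_cont)
  moreover have "N pi \<bullet> z = - (N 0 \<bullet> z)" by (simp add: Npi)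
  ultimately obtain t where "N t \<bullet> z = 0"
    using IVT'[of "\<lambda>t. N t \<bullet> z" 0 0 pi] IVT2'[of "\<lambda>t. N t \<bullet> z" pi 0 0]
    by (cases "N 0 \<bullet> z \<le> 0") auto
  then have "z \<in> \<sigma> (H t)" by (simp add: N(4))
  with HG wH show thesis by (rule that)
qed

section \<open>The highest point of a strictly convex body\<close>

lemma linear_max_not_interior:
  fixes K :: "'a::real_inner set"
  assumes "e \<noteq> 0" "\<And>x. x \<in> K \<Longrightarrow> e \<bullet> x \<le> M" "y \<in> interior K"
  shows "e \<bullet> y < M"
proof -
  obtain r where r: "r > 0" "cball y r \<subseteq> K"
    using assms(3) by (auto simp: mem_interior_cball)
  have "y + (r / norm e) *\<^sub>R e \<in> cball y r"
    using r assms(1) by (simp add: dist_norm)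
  then have "e \<bullet> (y + (r / norm e) *\<^sub>R e) \<le> M" using r assms(2) by blast
  moreover have "(r / norm e) * (e \<bullet> e) > 0" using r assms(1) by simp
  ultimately show ?thesis by (simp add: inner_add_right)
qed

lemma strictly_convex_body_unique_max:
  fixes K :: "'a::euclidean_space set"
  assumes K: "strictly_convex_body K" and e: "e \<noteq> 0"
  obtains q where "q \<in> K" "\<And>x. x \<in> K \<Longrightarrow> e \<bullet> q \<le> e \<bullet> x \<Longrightarrow> x = q" "\<And>x. x \<in> interior K \<Longrightarrow> e \<bullet> x < e \<bullet> q"
proof -
  have "compact K" "K \<noteq> {}"
    using K interior_subset by (auto simp: strictly_convex_body_def)
  then obtain q where q: "q \<in> K" "\<And>x. x \<in> K \<Longrightarrow> e \<bullet> x \<le> e \<bullet> q"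
    using continuous_attains_sup[of K "\<lambda>x. e \<bullet> x"] continuous_on_inner[OF continuous_on_const continuous_on_id]
    by blast
  have int: "e \<bullet> x < e \<bullet> q" if "x \<in> interior K" for x
    using linear_max_not_interior[OF e q(2) that] by simp
  show thesis
  proof (rule that[OF q(1) _ int])
    fix x assume x: "x \<in> K" "e \<bullet> q \<le> e \<bullet> x"
    show "x = q"
    proof (rule ccontr)
      assume "x \<noteq> q"
      then have "midpoint x q \<in> interior K"
        using K x(1) q(1) midpoint_in_open_segment[of x q] unfolding strictly_convex_body_def by blast
      then have "e \<bullet> midpoint x q < e \<bullet> q" by (rule int)
      then show False using x(2) by (simp add: midpoint_def inner_add_right)
    qed
  qed
qed

section \<open>The axis joins \<open>p\<close> to the highest point\<close>

lemma line_hyperplane_reflection_data: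
  fixes p d e :: "'a::euclidean_space"
  assumes "e \<bullet> d \<noteq> 0"
  defines "l \<equiv> range (\<lambda>c. p + c *\<^sub>R d)"
  shows "affine_line l" and "reflection_data UNIV l {y. e \<bullet> y = 0}"
proof -
  have d: "d \<noteq> 0" using assms by auto
  have dir: "direction l = span {d}"
  proof
    show "direction l \<subseteq> span {d}"
    proof
      fix y assume "y \<in> direction l"
      then obtain b c where "y = (p + b *\<^sub>R d) - (p + c *\<^sub>R d)"
        by (auto simp: direction_def l_def)
      then have "y = (b - c) *\<^sub>R d" by (simp add: algebra_simps)
      then show "y \<in> span {d}" by (auto simp: span_singleton)
    qed
    show "span {d} \<subseteq> direction l"
    proof
      fix y assume "y \<in> span {d}"
      then obtain c where "y = (p + c *\<^sub>R d) - (p + 0 *\<^sub>R d)" by (auto simp: span_singleton)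
      then show "y \<in> direction l" unfolding direction_def l_def by blast
    qed
  qed
  have l: "l = (+) p ` span {d}" by (auto simp: l_def span_singleton)
  have aff: "affine l" unfolding l using subspace_span subspace_imp_affine affine_translation by blast
  have "aff_dim l = 1"
    unfolding l using d by (simp add: aff_dim_translation_eq aff_dim_subspace)
  with aff show "affine_line l" by (simp add: affine_line_def)
  have "direct_sum UNIV (span {d}) {y. e \<bullet> y = 0}"
    unfolding direct_sum_def
  proof (intro conjI)
    show "subspace {y. e \<bullet> y = 0}" by (rule subspace_hyperplane)
    show "span {d} \<inter> {y. e \<bullet> y = 0} = {0}" using assms by (auto simp: span_singleton)
    have "x \<in> {a + b |a b. a \<in> span {d} \<and> b \<in> {y. e \<bullet> y = 0}}" for x
      using assms
      by (intro CollectI exI[of _ "((e \<bullet> x) / (e \<bullet> d)) *\<^sub>R d"] exI[of _ "x - ((e \<bullet> x) / (e \<bullet> d)) *\<^sub>R d"])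
        (auto simp: span_singleton inner_diff_right)
    then show "UNIV = {a + b |a b. a \<in> span {d} \<and> b \<in> {y. e \<bullet> y = 0}}" by blast
  qed simp
  moreover have "direction (UNIV :: 'a set) = UNIV"
  proof -
    have "x \<in> direction UNIV" for x :: 'a
      unfolding direction_def by (intro CollectI exI[of _ x] exI[of _ 0]) simp
    then show ?thesis by blast
  qed
  ultimately show "reflection_data UNIV l {y. e \<bullet> y = 0}"
    using aff dir by (simp add: reflection_data_def)
qed

text \<open>A reflection along a subspace of the horizontal hyperplane preserves heights, so it fixes the
  only highest point of an invariant body. Hence the axis passes through that point as soon as the
  section does.\<close>

lemma section_axis_through_highest_point:
  fixes K W H l :: "'a::euclidean_space set"
  assumes refl: "reflection_data W l H" "affine_reflection l H ` (K \<inter> W) = K \<inter> W" "l \<noteq> {}"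
    and H: "H \<subseteq> {y. e \<bullet> y = 0}"
    and q: "q \<in> K" "\<And>x. x \<in> K \<Longrightarrow> e \<bullet> q \<le> e \<bullet> x \<Longrightarrow> x = q"
    and W: "q \<in> W"
  shows "q \<in> l"
proof -
  obtain a v where av: "a \<in> l" "v \<in> H" "q = a + v"
    using reflection_data_decompose[OF refl(1) W refl(3)] by blast
  have "affine_reflection l H q = a - v"
    using refl(1) av by (auto simp: reflection_data_def intro: affine_reflection_eq)
  moreover have "affine_reflection l H q \<in> K \<inter> W"
    using imageI[of q "K \<inter> W" "affine_reflection l H"] q(1) W unfolding refl(2) by simp
  ultimately have "a - v \<in> K" by simp
  moreover have "e \<bullet> v = 0" using H av(2) by blast
  ultimately have "a - v = q" using q(2)[of "a - v"] av by (simp add: inner_add inner_diff)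
  then have "a - v = a + v" using av(3) by simp
  then have "2 *\<^sub>R v = 0" by (simp add: scaleR_2 diff_eq_eq add.assoc)
  then show ?thesis using av by simp
qed

theorem theorem3:
  fixes K T :: "(real ^ 4) set"
    and p :: "real ^ 4"
    and \<sigma> :: "(real ^ 4) set \<Rightarrow> (real ^ 4) set"
  assumes "strictly_convex_body K"
    and "p \<in> interior K"
    and "T \<in> Gr 3 UNIV"
    and "\<sigma> \<in> Gr 2 T \<rightarrow> Gr 3 UNIV"
    and "Lipschitz_continuous_map (hyperplane_metric T) (hyperplane_metric UNIV) \<sigma>"
    and "\<And>H. H \<in> Gr 2 T \<Longrightarrow> \<sigma> H \<inter> T = H"
    and "\<And>H. H \<in> Gr 2 T \<Longrightarrow>
           let W = (\<lambda>x. x + p) ` \<sigma> H in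
           \<exists>l. affine_line l \<and> p \<in> l \<and> reflection_data W l H \<and>
               affine_reflection l H ` (K \<inter> W) = K \<inter> W"
  shows "\<exists>l V. affine_line l \<and> p \<in> l \<and> subspace V \<and> dim V = 3 \<and>
               reflection_data UNIV l V \<and> affine_reflection l V ` K = K"
proof -
  have T: "subspace T" "dim T = 3" using assms(3) by (auto simp: Gr_def)
  obtain e where e: "norm e = 1" "T = {y. e \<bullet> y = 0}"
    using Gr_normal[of "UNIV :: (real ^ 4) set" T] assms(3) by auto
  have "e \<noteq> 0" using e(1) by auto
  then obtain q where q: "q \<in> K" "\<And>x. x \<in> K \<Longrightarrow> e \<bullet> q \<le> e \<bullet> x \<Longrightarrow> x = q"
      "\<And>x. x \<in> interior K \<Longrightarrow> e \<bullet> x < e \<bullet> q"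
    using strictly_convex_body_unique_max[OF assms(1)] by blast
  define d where "d = q - p"
  define L where "L = range (\<lambda>c. p + c *\<^sub>R d)"
  have ed: "e \<bullet> d > 0" using q(3)[OF assms(2)] by (simp add: d_def inner_diff_right)
  have L: "affine_line L" "reflection_data UNIV L T"
    using line_hyperplane_reflection_data[of e d p] ed e(2) by (simp_all add: L_def)
  have refl_L: "affine_reflection L T (p + c *\<^sub>R d + w) = p + c *\<^sub>R d - w" if "w \<in> T" for c w
    using L(2) that unfolding reflection_data_def by (intro affine_reflection_eq) (auto simp: L_def)
  have split: "\<exists>c w. w \<in> T \<and> x = p + c *\<^sub>R d + w" for x
    using ed by (intro exI[of _ "(e \<bullet> (x - p)) / (e \<bullet> d)"] exI[of _ "x - p - ((e \<bullet> (x - p)) / (e \<bullet> d)) *\<^sub>R d"])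
      (simp add: e(2) inner_diff_right)

  have inK: "p + c *\<^sub>R d - w \<in> K" if x: "p + c *\<^sub>R d + w \<in> K" and w: "w \<in> T" for c w
  proof -
    obtain H where H: "H \<in> Gr 2 T" "w \<in> H" "d \<in> \<sigma> H"
      using hyperplane_family_through[of T \<sigma> w d] T w assms(5,6) by auto
    define W where "W = (\<lambda>x. x + p) ` \<sigma> H"
    obtain l where l: "affine_line l" "p \<in> l" "reflection_data W l H"
        "affine_reflection l H ` (K \<inter> W) = K \<inter> W"
      using assms(7)[OF H(1)] unfolding W_def Let_def by blast
    have HT: "H \<subseteq> T" using H(1) by (auto simp: Gr_def)
    have "q \<in> W" using H(3) by (force simp: W_def d_def)
    then have "q \<in> l"
      using section_axis_through_highest_point[OF l(3,4)] l(2) HT e(2) q(1,2) by blast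
    then have "p + c *\<^sub>R d \<in> l"
      using l(1,2) mem_affine_3_minus[of l p q p c] by (auto simp: affine_line_def d_def)
    moreover have "direct_sum (direction W) (direction l) H"
      using l(3) by (simp add: reflection_data_def)
    ultimately have "affine_reflection l H (p + c *\<^sub>R d + w) = p + c *\<^sub>R d - w"
      using H(2) by (intro affine_reflection_eq)
    moreover have "p + c *\<^sub>R d + w \<in> W"
    proof -
      have "subspace (\<sigma> H)" using assms(4) H(1) by (auto simp: Gr_def)
      moreover have "w \<in> \<sigma> H" using assms(6)[OF H(1)] H(2) by auto
      ultimately have "c *\<^sub>R d + w \<in> \<sigma> H" using H(3) by (simp add: subspace_add subspace_scale)
      then show ?thesis by (force simp: W_def)
    qed
    ultimately show ?thesis using l(4) x by (metis Int_iff image_eqI)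
  qed
  have "affine_reflection L T ` K = K"
  proof
    show "affine_reflection L T ` K \<subseteq> K"
    proof
      fix y assume "y \<in> affine_reflection L T ` K"
      then obtain x where "x \<in> K" "y = affine_reflection L T x" by blast
      moreover obtain c w where "w \<in> T" "x = p + c *\<^sub>R d + w" using split by blast
      ultimately show "y \<in> K" using refl_L inK by simp
    qed
    show "K \<subseteq> affine_reflection L T ` K"
    proof
      fix x assume x: "x \<in> K"
      obtain c w where cw: "w \<in> T" "x = p + c *\<^sub>R d + w" using split by blast
      have "affine_reflection L T (p + c *\<^sub>R d + - w) = x"
        using refl_L[of "- w" c] cw T by (simp add: subspace_neg)
      moreover have "p + c *\<^sub>R d + - w \<in> K" using inK x cw by simp
      ultimately show "x \<in> affine_reflection L T ` K" by (metis image_eqI)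
    qed
  qed
  moreover have "p \<in> L" by (auto simp: L_def intro: range_eqI[of _ _ 0])
  ultimately show ?thesis using L T by blast
qed

end
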